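(* The set \[ \mathcal{L}_2 := \left\{ \left[ \bar{\alpha}^2 + \bar{\beta}^2 : \sqrt{2}(\bar{\alpha} \beta - \alpha \bar{\beta}) : \alpha^2 + \beta^2 \right] \;\middle|\; \alpha, \beta \in \mathbb{C},\ |\alpha|^2+|\beta|^2=1 \right\} \subset \mathbb{CP}^2 \] is a submanifold of $\mathbb{CP}^2$ diffeomorphic to $\mathbb{RP}^2$.
   Context: $\mathbb{CP}^2$ is the complex projective plane, viewed as a smooth (real 4-dimensional) manifold, with homogeneous coordinates $[z_0:z_1:z_2]$. Bars denote complex conjugation. "Submanifold" means smooth embedded real submanifold. *)

theory Defs
  imports "HOL-Analysis.Analysis"
begin

text \<open>These notions are only used for open sets \<open>S\<close> in finite-dimensional spaces, where
  continuity of all iterated directional derivatives up to order \<open>k\<close>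
  is the usual notion of being \<open>k\<close> times continuously differentiable.\<close>

primrec Ck_on :: "nat \<Rightarrow> 'a::euclidean_space set \<Rightarrow> ('a \<Rightarrow> 'b::euclidean_space) \<Rightarrow> bool" where
  "Ck_on 0 S f \<longleftrightarrow> continuous_on S f"
| "Ck_on (Suc k) S f \<longleftrightarrow> (\<forall>x\<in>S. f differentiable (at x)) \<and>
     (\<forall>v. Ck_on k S (\<lambda>x. frechet_derivative f (at x) v))"

definition smooth_on :: "'a::euclidean_space set \<Rightarrow> ('a \<Rightarrow> 'b::euclidean_space) \<Rightarrow> bool" where
  "smooth_on S f \<longleftrightarrow> (\<forall>k. Ck_on k S f)"

text \<open>The points of \<open>M\<close> are those of \<open>topspace (mtop M)\<close>. A chart is a pair of its domain and its
  coordinate map, whose values outside the domain are irrelevant. The atlas need not be maximal: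
  it stands for the smooth structure that it generates.\<close>

record ('a, 'e) manifold =
  mtop :: "'a topology"
  atlas :: "('a set \<times> ('a \<Rightarrow> 'e)) set"

definition chart :: "'a topology \<Rightarrow> 'a set \<Rightarrow> ('a \<Rightarrow> 'e::euclidean_space) \<Rightarrow> bool" where
  "chart X U \<phi> \<longleftrightarrow> openin X U \<and> open (\<phi> ` U) \<and>
     homeomorphic_map (subtopology X U) (top_of_set (\<phi> ` U)) \<phi>"

definition smooth_manifold :: "('a, 'e::euclidean_space) manifold \<Rightarrow> bool" where
  "smooth_manifold M \<longleftrightarrow>
     Hausdorff_space (mtop M) \<and> second_countable (mtop M) \<and>
     (\<forall>(U, \<phi>) \<in> atlas M. chart (mtop M) U \<phi>) \<and>
     (\<Union>(U, \<phi>) \<in> atlas M. U) = topspace (mtop M) \<and>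
     (\<forall>(U, \<phi>) \<in> atlas M. \<forall>(V, \<psi>) \<in> atlas M. smooth_on (\<phi> ` (U \<inter> V)) (\<psi> \<circ> inv_into U \<phi>))"

definition smooth_map ::
  "('a, 'e::euclidean_space) manifold \<Rightarrow> ('b, 'f::euclidean_space) manifold \<Rightarrow> ('a \<Rightarrow> 'b) \<Rightarrow> bool" where
  "smooth_map M N f \<longleftrightarrow>
     continuous_map (mtop M) (mtop N) f \<and>
     (\<forall>(U, \<phi>) \<in> atlas M. \<forall>(V, \<psi>) \<in> atlas N.
        smooth_on (\<phi> ` (U \<inter> f -` V)) (\<psi> \<circ> f \<circ> inv_into U \<phi>))"

definition immersion ::
  "('a, 'e::euclidean_space) manifold \<Rightarrow> ('b, 'f::euclidean_space) manifold \<Rightarrow> ('a \<Rightarrow> 'b) \<Rightarrow> bool" where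
  "immersion M N f \<longleftrightarrow>
     smooth_map M N f \<and>
     (\<forall>(U, \<phi>) \<in> atlas M. \<forall>(V, \<psi>) \<in> atlas N. \<forall>x \<in> \<phi> ` (U \<inter> f -` V).
        inj (frechet_derivative (\<psi> \<circ> f \<circ> inv_into U \<phi>) (at x)))"

definition diffeomorphic ::
  "('a, 'e::euclidean_space) manifold \<Rightarrow> ('b, 'f::euclidean_space) manifold \<Rightarrow> bool" where
  "diffeomorphic M N \<longleftrightarrow>
     smooth_manifold M \<and> smooth_manifold N \<and>
     (\<exists>f g. smooth_map M N f \<and> smooth_map N M g \<and>
        (\<forall>x \<in> topspace (mtop M). g (f x) = x) \<and> (\<forall>y \<in> topspace (mtop N). f (g y) = y))"

text \<open>\<open>S\<close> carries the subspace topology of \<open>M\<close>, so that the inclusion is a smooth embedding;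
  its smooth structure is then determined by its set of points.\<close>

definition embedded_submanifold ::
  "('a, 'e::euclidean_space) manifold \<Rightarrow> ('a, 'f::euclidean_space) manifold \<Rightarrow> bool" where
  "embedded_submanifold S M \<longleftrightarrow>
     smooth_manifold S \<and> smooth_manifold M \<and>
     topspace (mtop S) \<subseteq> topspace (mtop M) \<and>
     mtop S = subtopology (mtop M) (topspace (mtop S)) \<and>
     immersion S M (\<lambda>p. p)"

definition proj_rel :: "('k::field) ^ 3 \<Rightarrow> 'k ^ 3 \<Rightarrow> bool" where
  "proj_rel z w \<longleftrightarrow> z \<noteq> 0 \<and> w \<noteq> 0 \<and> (\<exists>c. w = c *s z)"

quotient_type (overloaded) 'k proj_plane = "('k::field) ^ 3" / partial: proj_rel
proof (rule part_equivpI)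
  show "\<exists>z::'k ^ 3. proj_rel z z"
    by (rule exI[of _ "axis 1 1"]) (auto simp: proj_rel_def intro: exI[of _ 1])
  show "symp (proj_rel :: 'k ^ 3 \<Rightarrow> _)"
  proof (rule sympI)
    fix z w :: "'k ^ 3"
    assume "proj_rel z w"
    then obtain c where "z \<noteq> 0" "w \<noteq> 0" "w = c *s z"
      by (auto simp: proj_rel_def)
    moreover from this have "c \<noteq> 0" by auto
    ultimately have "z = inverse c *s w" by (simp add: vector_smult_assoc)
    then show "proj_rel w z"
      using \<open>z \<noteq> 0\<close> \<open>w \<noteq> 0\<close> by (auto simp: proj_rel_def)
  qed
  show "transp (proj_rel :: 'k ^ 3 \<Rightarrow> _)"
    by (rule transpI) (auto simp: proj_rel_def vector_smult_assoc)
qed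

text \<open>The point with homogeneous coordinates \<open>[a : b : c]\<close>; the value is unspecified if
  all three of them are zero.\<close>

definition hom_coords :: "'k::field \<Rightarrow> 'k \<Rightarrow> 'k \<Rightarrow> 'k proj_plane" where
  "hom_coords a b c = abs_proj_plane (vector [a, b, c])"

text \<open>The quotient topology of the space of nonzero vectors\<close>

instantiation proj_plane :: (real_normed_field) topological_space
begin

definition open_proj_plane :: "'a proj_plane set \<Rightarrow> bool" where
  "open_proj_plane W \<longleftrightarrow> open {z. z \<noteq> 0 \<and> abs_proj_plane z \<in> W}"

instance
proof
  have "{z::'a ^ 3. z \<noteq> 0} = - {0}" by auto
  then show "open (UNIV :: 'a proj_plane set)"
    by (simp add: open_proj_plane_def open_Compl)
next
  fix S T :: "'a proj_plane set"
  assume "open S" "open T"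
  then have "open ({z. z \<noteq> 0 \<and> abs_proj_plane z \<in> S} \<inter> {z. z \<noteq> 0 \<and> abs_proj_plane z \<in> T})"
    unfolding open_proj_plane_def by (rule open_Int)
  then show "open (S \<inter> T)"
    unfolding open_proj_plane_def by (rule back_subst[where P = "open"]) auto
next
  fix K :: "'a proj_plane set set"
  assume "\<forall>S\<in>K. open S"
  then have "open (\<Union>S\<in>K. {z. z \<noteq> 0 \<and> abs_proj_plane z \<in> S})"
    unfolding open_proj_plane_def by (intro open_UN) auto
  then show "open (\<Union>K)"
    unfolding open_proj_plane_def by (rule back_subst[where P = "open"]) auto
qed

end

text \<open>Arithmetic in the index type \<open>3\<close> is modulo \<open>3\<close>, so \<open>i + 1\<close> and \<open>i + 2\<close> are the two
  indices other than \<open>i\<close>.\<close>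

lift_definition affine_part :: "3 \<Rightarrow> 'k::field proj_plane \<Rightarrow> bool" is
  "\<lambda>i z. z $ i \<noteq> 0"
  by (auto simp: proj_rel_def)

lift_definition affine_coords :: "3 \<Rightarrow> 'k::field proj_plane \<Rightarrow> 'k \<times> 'k" is
  "\<lambda>i z. (z $ (i + 1) / z $ i, z $ (i + 2) / z $ i)"
  by (auto simp: proj_rel_def)

definition projective_plane ::
  "('k::{real_normed_field, euclidean_space} proj_plane, 'k \<times> 'k) manifold" where
  "projective_plane =
     \<lparr>mtop = euclidean, atlas = range (\<lambda>i. ({p. affine_part i p}, affine_coords i))\<rparr>"

abbreviation CP2 :: "(complex proj_plane, complex \<times> complex) manifold" where
  "CP2 \<equiv> projective_plane"

abbreviation RP2 :: "(real proj_plane, real \<times> real) manifold" where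
  "RP2 \<equiv> projective_plane"

definition L2 :: "complex proj_plane set" where
  "L2 = {hom_coords ((cnj \<alpha>)\<^sup>2 + (cnj \<beta>)\<^sup>2)
                    (complex_of_real (sqrt 2) * (cnj \<alpha> * \<beta> - \<alpha> * cnj \<beta>))
                    (\<alpha>\<^sup>2 + \<beta>\<^sup>2)
         | \<alpha> \<beta>. (cmod \<alpha>)\<^sup>2 + (cmod \<beta>)\<^sup>2 = 1}"

end

theory Submission
  imports Defs
begin

text \<open>Write \<open>u, v \<in> \<real>\<^sup>2\<close> for the real and imaginary parts of \<open>(\<alpha>, \<beta>)\<close> and put
  \<open>X = |u|\<^sup>2 - |v|\<^sup>2\<close>, \<open>Y = 2 u \<bullet> v\<close>, \<open>Z = 2 det (u, v)\<close>. Then \<open>(X, Y, Z)\<close> runs through the unit sphere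
  (this is the Hopf fibration) and the point of \<open>\<L>\<^sub>2\<close> is \<open>[X - iY : i \<surd>2 Z : X + iY]\<close>.
  So \<open>\<L>\<^sub>2\<close> is the image of the standard \<open>\<real>P\<^sup>2\<close> under an invertible complex
  linear change of homogeneous coordinates. The induced map is an immersion, because in charts the
  inverse matrix gives it a differentiable left inverse, and it is a topological embedding, because
  \<open>\<real>P\<^sup>2\<close> is compact. The smooth structure of \<open>\<real>P\<^sup>2\<close> is carried over along it.\<close>

section \<open>Differentiable functions\<close>

text \<open>\<open>frechet_derivative\<close> is a choice among the derivatives at \<open>x\<close>.
  Functions that agree near \<open>x\<close> have the same derivatives there, so the choices
  coincide, even if there is no derivative at all.\<close>

lemma frechet_derivative_cong_open:
  assumes "open T" "x \<in> T" "\<And>y. y \<in> T \<Longrightarrow> f y = g y"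
  shows "frechet_derivative f (at x) = frechet_derivative g (at x)"
proof -
  have "(f has_derivative d) (at x) \<longleftrightarrow> (g has_derivative d) (at x)" for d
    using has_derivative_transform_within_open[of f d x UNIV T g]
      has_derivative_transform_within_open[of g d x UNIV T f] assms by auto
  then show ?thesis by (simp add: frechet_derivative_def)
qed

text \<open>Derivatives at points of \<open>S\<close> depend on values around them, hence the
  agreement on an open \<open>T\<close>. It passes to the directional derivatives, to which the
  induction hypothesis is applied.\<close>

lemma Ck_on_cong:
  assumes "Ck_on k S f" "open T" "S \<subseteq> T" "\<And>y. y \<in> T \<Longrightarrow> f y = g y"
  shows "Ck_on k S g"
  using assms(1,4)
proof (induction k arbitrary: f g)
  case 0
  have "continuous_on S f \<longleftrightarrow> continuous_on S g"
    by (rule continuous_on_cong) (use 0 assms(3) in blast)+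
  then show ?case using 0 by simp
next
  case (Suc k)
  have "g differentiable (at x)" if "x \<in> S" for x
  proof -
    obtain d where "(f has_derivative d) (at x)"
      using Suc.prems(1) \<open>x \<in> S\<close> by (auto simp: differentiable_def)
    then have "(g has_derivative d) (at x)"
      by (rule has_derivative_transform_within_open[OF _ \<open>open T\<close>])
         (use Suc.prems(2) assms(3) \<open>x \<in> S\<close> in auto)
    then show ?thesis by (auto simp: differentiable_def)
  qed
  moreover have "Ck_on k S (\<lambda>x. frechet_derivative g (at x) v)" for v
  proof (rule Suc.IH)
    show "Ck_on k S (\<lambda>x. frechet_derivative f (at x) v)" using Suc.prems by simp
  next
    fix y assume "y \<in> T"
    then show "frechet_derivative f (at y) v = frechet_derivative g (at y) v"
      using frechet_derivative_cong_open[of T y f g] assms(2) Suc.prems(2) by simp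
  qed
  ultimately show ?case by simp
qed

text \<open>The entrance for the rules of calculus: an explicit derivative \<open>f'\<close> may
  replace the chosen \<open>frechet_derivative\<close>.\<close>

lemma Ck_on_Suc_has_derivative:
  assumes "open S" "\<And>x. x \<in> S \<Longrightarrow> (f has_derivative f' x) (at x)" "\<And>v. Ck_on k S (\<lambda>x. f' x v)"
  shows "Ck_on (Suc k) S f"
proof -
  have "Ck_on k S (\<lambda>x. frechet_derivative f (at x) v)" for v
    by (rule Ck_on_cong[OF assms(3) \<open>open S\<close> order_refl])
       (simp add: frechet_derivative_at[OF assms(2), symmetric])
  then show ?thesis
    using assms(2) by (auto simp: differentiable_def)
qed

lemma Ck_on_frechet_derivative:
  "Ck_on (Suc k) S f \<Longrightarrow> Ck_on k S (\<lambda>x. frechet_derivative f (at x) v)"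
  by simp

text \<open>At the bottom, differentiability gives continuity. The lemma serves the rules for
  products and inverses, whose derivatives contain the functions themselves.\<close>

lemma Ck_on_SucD: "Ck_on (Suc k) S f \<Longrightarrow> Ck_on k S f"
proof (induction k arbitrary: f)
  case 0
  then show ?case
    by (simp add: continuous_at_imp_continuous_on differentiable_imp_continuous_within)
next
  case (Suc k)
  have "Ck_on k S (\<lambda>x. frechet_derivative f (at x) v)" for v
    by (rule Suc.IH[OF Ck_on_frechet_derivative[OF Suc.prems]])
  moreover have "\<forall>x\<in>S. f differentiable (at x)"
    using Suc.prems by (subst (asm) Ck_on.simps) blast
  ultimately show ?case
    by (subst Ck_on.simps) blast
qed

lemma Ck_on_has_derivative:
  assumes "Ck_on (Suc k) S f" "x \<in> S"
  shows "(f has_derivative frechet_derivative f (at x)) (at x)"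
  using assms by (simp add: frechet_derivative_works)

lemma Ck_on_const: "Ck_on k S (\<lambda>x. c)"
  by (induction k arbitrary: c) auto

text \<open>The derivative is \<open>L\<close> at every point, so the directional derivatives are
  constant.\<close>

lemma Ck_on_affine:
  assumes "bounded_linear L" "open S"
  shows "Ck_on k S (\<lambda>x. c + L x)"
proof (cases k)
  case 0
  then show ?thesis
    using assms by (simp add: continuous_on_add continuous_on_const linear_continuous_on)
next
  case (Suc k)
  have "((\<lambda>x. c + L x) has_derivative L) (at x)" for x
    using has_derivative_add[OF has_derivative_const bounded_linear_imp_has_derivative[OF assms(1)]]
    by simp
  then show ?thesis
    unfolding Suc by (rule Ck_on_Suc_has_derivative[OF assms(2) _ Ck_on_const])
qed

lemma Ck_on_add:
  assumes "open S" "Ck_on k S f" "Ck_on k S g"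
  shows "Ck_on k S (\<lambda>x. f x + g x)"
  using assms(2,3)
proof (induction k arbitrary: f g)
  case 0
  then show ?case by (simp add: continuous_on_add)
next
  case (Suc k)
  show ?case
    by (rule Ck_on_Suc_has_derivative[OF \<open>open S\<close>
          has_derivative_add[OF Suc.prems[THEN Ck_on_has_derivative]]])
       (assumption | intro Suc.IH Suc.prems[THEN Ck_on_frechet_derivative])+
qed

lemma Ck_on_Pair:
  assumes "open S" "Ck_on k S f" "Ck_on k S g"
  shows "Ck_on k S (\<lambda>x. (f x, g x))"
  using assms(2,3)
proof (induction k arbitrary: f g)
  case 0
  then show ?case by (simp add: continuous_on_Pair)
next
  case (Suc k)
  show ?case
    by (rule Ck_on_Suc_has_derivative[OF \<open>open S\<close>
          has_derivative_Pair[OF Suc.prems[THEN Ck_on_has_derivative]]])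
       (assumption | intro Suc.IH Suc.prems[THEN Ck_on_frechet_derivative])+
qed

text \<open>By the product rule the derivative is a sum of two products, each of a factor, lowered
  to order \<open>k\<close>, and a directional derivative of order \<open>k\<close>.\<close>

lemma Ck_on_mult:
  fixes f g :: "'a::euclidean_space \<Rightarrow> 'k::{real_normed_field, euclidean_space}"
  assumes "open S" "Ck_on k S f" "Ck_on k S g"
  shows "Ck_on k S (\<lambda>x. f x * g x)"
  using assms(2,3)
proof (induction k arbitrary: f g)
  case 0
  then show ?case by (simp add: continuous_on_mult)
next
  case (Suc k)
  show ?case
    by (rule Ck_on_Suc_has_derivative[OF \<open>open S\<close>
          has_derivative_mult[OF Suc.prems[THEN Ck_on_has_derivative]]])
       (assumption | intro Ck_on_add Suc.IH Suc.prems[THEN Ck_on_SucD] Suc.prems[THEN Ck_on_frechet_derivative]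
          \<open>open S\<close>)+
qed

text \<open>The derivative of the inverse contains the inverse again, which has order
  \<open>k\<close> by induction; so the induction keeps \<open>f\<close> fixed.\<close>

lemma Ck_on_inverse:
  fixes f :: "'a::euclidean_space \<Rightarrow> 'k::{real_normed_field, euclidean_space}"
  assumes "open S" "Ck_on k S f" "\<And>x. x \<in> S \<Longrightarrow> f x \<noteq> 0"
  shows "Ck_on k S (\<lambda>x. inverse (f x))"
  using assms(2)
proof (induction k)
  case 0
  then show ?case using assms(3) by (simp add: continuous_on_inverse)
next
  case (Suc k)
  have IH: "Ck_on k S (\<lambda>x. inverse (f x))"
    by (rule Suc.IH[OF Ck_on_SucD[OF Suc.prems]])
  \<comment> \<open>Negation is written as multiplication by a constant, so that
    \<open>Ck_on_mult\<close> covers it.\<close>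
  have "Ck_on k S (\<lambda>x. - 1 * (inverse (f x) * frechet_derivative f (at x) v * inverse (f x)))" for v
    by (intro Ck_on_mult Ck_on_const \<open>open S\<close> IH Suc.prems[THEN Ck_on_frechet_derivative])
  then have D: "Ck_on k S (\<lambda>x. - (inverse (f x) * frechet_derivative f (at x) v * inverse (f x)))" for v
    by simp
  show ?case
    by (rule Ck_on_Suc_has_derivative[OF \<open>open S\<close> Deriv.has_derivative_inverse
          [OF assms(3) Ck_on_has_derivative[OF Suc.prems]] D])
qed

lemma smooth_on_cong:
  assumes "smooth_on S f" "open T" "S \<subseteq> T" "\<And>y. y \<in> T \<Longrightarrow> f y = g y"
  shows "smooth_on S g"
  using assms Ck_on_cong unfolding smooth_on_def by blast

lemma smooth_on_Pair: "open S \<Longrightarrow> smooth_on S f \<Longrightarrow> smooth_on S g \<Longrightarrow> smooth_on S (\<lambda>x. (f x, g x))"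
  by (simp add: smooth_on_def Ck_on_Pair)

lemma smooth_on_divide:
  fixes f g :: "'a::euclidean_space \<Rightarrow> 'k::{real_normed_field, euclidean_space}"
  assumes "open S" "smooth_on S f" "smooth_on S g" "\<And>x. x \<in> S \<Longrightarrow> g x \<noteq> 0"
  shows "smooth_on S (\<lambda>x. f x / g x)"
  using assms by (simp add: smooth_on_def divide_inverse Ck_on_mult Ck_on_inverse)

text \<open>By the chain rule the derivatives of \<open>g\<close> and \<open>f\<close> compose to
  that of \<open>\<iota>\<close>, which is \<open>\<iota>\<close> by linearity; an injective
  composite has an injective inner map.\<close>

lemma inj_frechet_derivative_left_inverse:
  assumes "f differentiable (at x)" "g differentiable (at (f x))"
    and "open S" "x \<in> S" "\<And>y. y \<in> S \<Longrightarrow> g (f y) = \<iota> y" "bounded_linear \<iota>" "inj \<iota>"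
  shows "inj (frechet_derivative f (at x))"
proof -
  have "((g \<circ> f) has_derivative frechet_derivative g (at (f x)) \<circ> frechet_derivative f (at x)) (at x)"
    using assms(1,2) by (intro diff_chain_at) (simp_all add: frechet_derivative_works)
  then have "(\<iota> has_derivative frechet_derivative g (at (f x)) \<circ> frechet_derivative f (at x)) (at x)"
    by (rule has_derivative_transform_within_open[OF _ assms(3,4)]) (simp add: assms(5))
  then have "frechet_derivative g (at (f x)) \<circ> frechet_derivative f (at x) = \<iota>"
    using bounded_linear_imp_has_derivative[OF assms(6)] has_derivative_unique by blast
  then show ?thesis
    using assms(7) inj_on_imageI2 by metis
qed

lemma smooth_on_differentiable: "smooth_on S f \<Longrightarrow> x \<in> S \<Longrightarrow> f differentiable (at x)"
  unfolding smooth_on_def by (metis Ck_on.simps(2))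

section \<open>Transport of a smooth structure along a homeomorphism\<close>

text \<open>Intended for a homeomorphism \<open>f\<close> onto \<open>X\<close> with inverse
  \<open>g\<close>. The topology is a parameter so that it can be taken to be a subspace
  topology.\<close>

definition transport ::
  "'b topology \<Rightarrow> ('a \<Rightarrow> 'b) \<Rightarrow> ('b \<Rightarrow> 'a) \<Rightarrow> ('a, 'e) manifold \<Rightarrow> ('b, 'e) manifold" where
  "transport X f g M = \<lparr>mtop = X, atlas = (\<lambda>(U, \<phi>). (f ` U, \<phi> \<circ> g)) ` atlas M\<rparr>"

lemma mtop_transport [simp]: "mtop (transport X f g M) = X"
  by (simp add: transport_def)

lemma atlas_transportE:
  assumes "(U', \<phi>') \<in> atlas (transport X f g M)"
  obtains U \<phi> where "(U, \<phi>) \<in> atlas M" "U' = f ` U" "\<phi>' = \<phi> \<circ> g"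
  using assms by (auto simp: transport_def)

lemma smooth_manifold_transition:
  assumes "smooth_manifold M" "(U, \<phi>) \<in> atlas M" "(V, \<psi>) \<in> atlas M"
  shows "smooth_on (\<phi> ` (U \<inter> V)) (\<psi> \<circ> inv_into U \<phi>)"
proof -
  have *: "\<forall>(U, \<phi>)\<in>atlas M. \<forall>(V, \<psi>)\<in>atlas M. smooth_on (\<phi> ` (U \<inter> V)) (\<psi> \<circ> inv_into U \<phi>)"
    using assms(1) by (simp add: smooth_manifold_def)
  show ?thesis
    using bspec[OF bspec[OF * assms(2), unfolded prod.case] assms(3)] by simp
qed

lemma smooth_map_smooth_on:
  assumes "smooth_map M N f" "(U, \<phi>) \<in> atlas M" "(V, \<psi>) \<in> atlas N"
  shows "smooth_on (\<phi> ` (U \<inter> f -` V)) (\<psi> \<circ> f \<circ> inv_into U \<phi>)"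
proof -
  have *: "\<forall>(U, \<phi>)\<in>atlas M. \<forall>(V, \<psi>)\<in>atlas N.
      smooth_on (\<phi> ` (U \<inter> f -` V)) (\<psi> \<circ> f \<circ> inv_into U \<phi>)"
    using assms(1) by (simp add: smooth_map_def)
  show ?thesis
    using bspec[OF bspec[OF * assms(2), unfolded prod.case] assms(3)] by simp
qed

lemma immersion_inj:
  assumes "immersion M N f" "(U, \<phi>) \<in> atlas M" "(V, \<psi>) \<in> atlas N" "x \<in> \<phi> ` (U \<inter> f -` V)"
  shows "inj (frechet_derivative (\<psi> \<circ> f \<circ> inv_into U \<phi>) (at x))"
proof -
  have *: "\<forall>(U, \<phi>)\<in>atlas M. \<forall>(V, \<psi>)\<in>atlas N. \<forall>x\<in>\<phi> ` (U \<inter> f -` V).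
      inj (frechet_derivative (\<psi> \<circ> f \<circ> inv_into U \<phi>) (at x))"
    using assms(1) by (simp add: immersion_def)
  show ?thesis
    using bspec[OF bspec[OF * assms(2), unfolded prod.case] assms(3)] assms(4) unfolding prod.case by (rule bspec)
qed

lemma smooth_mapI:
  assumes "continuous_map (mtop M) (mtop N) f"
    and "\<And>U \<phi> V \<psi>. (U, \<phi>) \<in> atlas M \<Longrightarrow> (V, \<psi>) \<in> atlas N \<Longrightarrow>
      smooth_on (\<phi> ` (U \<inter> f -` V)) (\<psi> \<circ> f \<circ> inv_into U \<phi>)"
  shows "smooth_map M N f"
  unfolding smooth_map_def using assms by (intro conjI ballI case_prodI2) simp_all

lemma immersionI:
  assumes "smooth_map M N f"
    and "\<And>U \<phi> V \<psi> x. (U, \<phi>) \<in> atlas M \<Longrightarrow> (V, \<psi>) \<in> atlas N \<Longrightarrow> x \<in> \<phi> ` (U \<inter> f -` V) \<Longrightarrow>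
      inj (frechet_derivative (\<psi> \<circ> f \<circ> inv_into U \<phi>) (at x))"
  shows "immersion M N f"
  unfolding immersion_def using assms
  by (intro conjI ballI case_prodI2) simp_all

lemma smooth_manifoldI:
  assumes "Hausdorff_space (mtop M)" "second_countable (mtop M)"
    and "\<And>U \<phi>. (U, \<phi>) \<in> atlas M \<Longrightarrow> chart (mtop M) U \<phi>"
    and "\<Union> (fst ` atlas M) = topspace (mtop M)"
    and "\<And>U \<phi> V \<psi>. (U, \<phi>) \<in> atlas M \<Longrightarrow> (V, \<psi>) \<in> atlas M \<Longrightarrow>
      smooth_on (\<phi> ` (U \<inter> V)) (\<psi> \<circ> inv_into U \<phi>)"
  shows "smooth_manifold M"
proof -
  have "(\<Union>(U, \<phi>)\<in>atlas M. U) = \<Union> (fst ` atlas M)"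
    by (simp add: case_prod_unfold)
  then show ?thesis
    unfolding smooth_manifold_def using assms
    by (intro conjI ballI case_prodI2) simp_all
qed

lemma chart_subset: "chart X U \<phi> \<Longrightarrow> U \<subseteq> topspace X"
  by (simp add: chart_def openin_subset)

lemma chart_inj_on:
  assumes "chart X U \<phi>"
  shows "inj_on \<phi> U"
  using assms chart_subset[OF assms]
  by (auto simp: chart_def homeomorphic_eq_everything_map Int_absorb1)

text \<open>As \<open>g\<close> undoes \<open>f\<close> on \<open>U\<close>, the map
  \<open>\<phi> \<circ> g\<close> is injective on the image of \<open>U\<close>, which leaves
  \<open>inv_into\<close> a single choice.\<close>

lemma inv_into_transport:
  assumes "inj_on \<phi> U" "\<And>x. x \<in> U \<Longrightarrow> g (f x) = x" "y \<in> \<phi> ` U"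
  shows "inv_into (f ` U) (\<phi> \<circ> g) y = f (inv_into U \<phi> y)"
proof -
  obtain x where x: "x \<in> U" "y = \<phi> x" using assms(3) by blast
  have "inj_on (\<phi> \<circ> g) (f ` U)"
    using assms(1,2) by (auto simp: inj_on_def)
  then have "inv_into (f ` U) (\<phi> \<circ> g) ((\<phi> \<circ> g) (f x)) = f x"
    using x by (intro inv_into_f_f) auto
  then show ?thesis
    using x assms by simp
qed

context
  fixes M :: "('a, 'e::euclidean_space) manifold" and X :: "'b topology" and f g
  assumes M: "smooth_manifold M" and fg: "homeomorphic_maps (mtop M) X f g"
begin

lemma transport_inverse:
  assumes "(U, \<phi>) \<in> atlas M" "x \<in> U"
  shows "g (f x) = x"
proof -
  have "x \<in> topspace (mtop M)"
    using M assms unfolding smooth_manifold_def by blast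
  then show ?thesis
    using fg by (simp add: homeomorphic_maps_def)
qed

text \<open>\<open>g\<close> restricts to a homeomorphism from the image of \<open>U\<close> onto
  \<open>U\<close>, and \<open>\<phi>\<close> continues it into the coordinate space.\<close>

lemma transport_chart:
  assumes "(U, \<phi>) \<in> atlas M"
  shows "chart X (f ` U) (\<phi> \<circ> g)"
proof -
  have c: "chart (mtop M) U \<phi>" using M assms by (auto simp: smooth_manifold_def)
  have hf: "homeomorphic_map (mtop M) X f" and hg: "homeomorphic_map X (mtop M) g"
    using fg by (auto simp: homeomorphic_maps_map)
  have gfU: "g ` f ` U = U"
    using transport_inverse[OF assms] by (force simp: image_iff)
  have "openin X (f ` U)"
    using c homeomorphic_map_openness_eq[OF hf] by (simp add: chart_def)
  moreover from this have "homeomorphic_map (subtopology X (f ` U)) (subtopology (mtop M) U) g"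
    using hg gfU chart_subset[OF c]
    by (intro homeomorphic_map_subtopologies) (auto dest!: openin_subset simp: Int_absorb1)
  moreover have "(\<phi> \<circ> g) ` f ` U = \<phi> ` U"
    by (metis gfU image_comp)
  ultimately show ?thesis
    using c homeomorphic_map_compose unfolding chart_def by metis
qed

text \<open>\<open>g\<close> cancels \<open>f\<close>, so coordinate domains of the transported
  manifold turn into coordinate domains computed in \<open>M\<close>.\<close>

lemma transport_image:
  assumes "(U, \<phi>) \<in> atlas M"
  shows "(\<phi> \<circ> g) ` (f ` U \<inter> V) = \<phi> ` (U \<inter> f -` V)"
  using transport_inverse[OF assms] by (force simp: image_iff)

lemma transport_inv_into:
  assumes "(U, \<phi>) \<in> atlas M" "y \<in> \<phi> ` U"
  shows "inv_into (f ` U) (\<phi> \<circ> g) y = f (inv_into U \<phi> y)"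
  using M assms transport_inverse[OF assms(1)]
  by (intro inv_into_transport chart_inj_on[of "mtop M"]) (auto simp: smooth_manifold_def)

lemma open_chart_image:
  assumes "(U, \<phi>) \<in> atlas M"
  shows "open (\<phi> ` U)"
  using M assms by (auto simp: smooth_manifold_def chart_def)

lemma atlas_vimage:
  assumes "(U, \<phi>) \<in> atlas M" "(V, \<psi>) \<in> atlas M"
  shows "U \<inter> f -` f ` V = U \<inter> V"
proof -
  have "x = y" if "x \<in> U" "y \<in> V" "f x = f y" for x y
    using transport_inverse[OF assms(1), of x] transport_inverse[OF assms(2), of y] that by metis
  then show ?thesis by blast
qed

text \<open>The topological conditions are invariant under homeomorphism, and the transition maps
  are those of \<open>M\<close>, because \<open>g\<close> and \<open>f\<close> cancel between the
  two charts.\<close>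

lemma smooth_manifold_transport: "smooth_manifold (transport X f g M)"
proof -
  have hf: "homeomorphic_map (mtop M) X f"
    using fg by (auto simp: homeomorphic_maps_map)
  then have "mtop M homeomorphic_space X"
    using homeomorphic_map_imp_homeomorphic_space by blast
  then have "Hausdorff_space X" "second_countable X"
    using M homeomorphic_Hausdorff_space homeomorphic_space_second_countability
    unfolding smooth_manifold_def by metis+
  moreover have "\<Union> (fst ` atlas (transport X f g M)) = topspace X"
  proof -
    have "\<Union> (fst ` atlas (transport X f g M)) = f ` (\<Union>(U, \<phi>)\<in>atlas M. U)"
      by (auto simp: transport_def image_UN)
    also have "\<dots> = topspace X"
      using M homeomorphic_imp_surjective_map[OF hf] by (simp add: smooth_manifold_def)
    finally show ?thesis .
  qed
  moreover have "smooth_on ((\<phi> \<circ> g) ` (f ` U \<inter> f ` V)) ((\<psi> \<circ> g) \<circ> inv_into (f ` U) (\<phi> \<circ> g))"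
    if c: "(U, \<phi>) \<in> atlas M" "(V, \<psi>) \<in> atlas M" for U \<phi> V \<psi>
    unfolding transport_image[OF c(1)] atlas_vimage[OF c]
    by (rule smooth_on_cong[OF smooth_manifold_transition[OF M c] open_chart_image[OF c(1)] image_mono])
       (simp_all add: transport_inv_into[OF c(1)] transport_inverse[OF c(2)]
          transport_inverse[OF c(1) inv_into_into])
  ultimately show ?thesis
    by (intro smooth_manifoldI) (auto elim!: atlas_transportE intro: transport_chart)
qed

text \<open>In the charts both \<open>f\<close> and \<open>g\<close> become transition maps of
  \<open>M\<close>, so their smoothness is the compatibility of the atlas of
  \<open>M\<close>.\<close>

lemma diffeomorphic_transport: "diffeomorphic (transport X f g M) M"
proof -
  have "smooth_map (transport X f g M) M g"
  proof (rule smooth_mapI)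
    fix U' \<phi>' V \<psi>
    assume "(U', \<phi>') \<in> atlas (transport X f g M)" and c': "(V, \<psi>) \<in> atlas M"
    then obtain U \<phi> where c: "(U, \<phi>) \<in> atlas M" and U': "U' = f ` U" "\<phi>' = \<phi> \<circ> g"
      by (elim atlas_transportE)
    have "U \<inter> f -` g -` V = U \<inter> V"
      using transport_inverse[OF c] by auto
    then show "smooth_on (\<phi>' ` (U' \<inter> g -` V)) (\<psi> \<circ> g \<circ> inv_into U' \<phi>')"
      unfolding U' transport_image[OF c]
      by (simp only:)
         (rule smooth_on_cong[OF smooth_manifold_transition[OF M c c'] open_chart_image[OF c] image_mono],
          simp_all add: transport_inv_into[OF c] transport_inverse[OF c inv_into_into])
  qed (use fg in \<open>simp add: homeomorphic_maps_def\<close>)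
  moreover have "smooth_map M (transport X f g M) f"
  proof (rule smooth_mapI)
    fix U \<phi> V' \<psi>'
    assume c: "(U, \<phi>) \<in> atlas M" and "(V', \<psi>') \<in> atlas (transport X f g M)"
    then obtain V \<psi> where c': "(V, \<psi>) \<in> atlas M" and V': "V' = f ` V" "\<psi>' = \<psi> \<circ> g"
      by (elim atlas_transportE)
    show "smooth_on (\<phi> ` (U \<inter> f -` V')) (\<psi>' \<circ> f \<circ> inv_into U \<phi>)"
      unfolding V' atlas_vimage[OF c c']
      by (rule smooth_on_cong[OF smooth_manifold_transition[OF M c c'] open_chart_image[OF c] image_mono])
         (simp_all add: transport_inverse[OF c inv_into_into])
  qed (use fg in \<open>simp add: homeomorphic_maps_def\<close>)
  ultimately show ?thesis
    using M fg smooth_manifold_transport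
    unfolding diffeomorphic_def homeomorphic_maps_def mtop_transport by blast
qed

text \<open>In transported charts the inclusion has the same coordinate expression as
  \<open>f\<close> has in the charts of \<open>M\<close>, so it inherits smoothness and injective
  derivatives.\<close>

lemma embedded_submanifold_transport:
  assumes N: "smooth_manifold N" and X: "X = subtopology (mtop N) (topspace X)"
    and f: "immersion M N f"
  shows "embedded_submanifold (transport X f g M) N"
proof -
  have sub: "topspace X \<subseteq> topspace (mtop N)"
    using X topspace_subtopology by (metis inf.cobounded1)
  have incl: "continuous_map X (mtop N) (\<lambda>p. p)"
    by (subst X) (rule continuous_map_from_subtopology[OF continuous_map_id[unfolded id_def]])
  \<comment> \<open>The equality holds on a whole chart image, which is open; that is what carries
    it over to derivatives.\<close>
  have eq: "(\<psi> \<circ> f \<circ> inv_into U \<phi>) y = (\<psi> \<circ> (\<lambda>p. p) \<circ> inv_into (f ` U) (\<phi> \<circ> g)) y"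
    if "(U, \<phi>) \<in> atlas M" "y \<in> \<phi> ` U" for U \<phi> y and \<psi> :: "'b \<Rightarrow> 'f"
    using transport_inv_into[OF that] by simp
  have "smooth_map (transport X f g M) N (\<lambda>p. p)"
  proof (rule smooth_mapI)
    fix U' \<phi>' V \<psi>
    assume "(U', \<phi>') \<in> atlas (transport X f g M)" and c': "(V, \<psi>) \<in> atlas N"
    then obtain U \<phi> where c: "(U, \<phi>) \<in> atlas M" and U': "U' = f ` U" "\<phi>' = \<phi> \<circ> g"
      by (elim atlas_transportE)
    have "smooth_on (\<phi> ` (U \<inter> f -` V)) (\<psi> \<circ> f \<circ> inv_into U \<phi>)"
      using f c c' by (intro smooth_map_smooth_on) (auto simp: immersion_def)
    then show "smooth_on (\<phi>' ` (U' \<inter> (\<lambda>p. p) -` V)) (\<psi> \<circ> (\<lambda>p. p) \<circ> inv_into U' \<phi>')"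
      unfolding U' transport_image[OF c] vimage_ident
      by (rule smooth_on_cong[OF _ open_chart_image[OF c] image_mono eq[OF c]]) auto
  qed (simp add: incl)
  then have "immersion (transport X f g M) N (\<lambda>p. p)"
  proof (rule immersionI)
    fix U' \<phi>' V \<psi> x
    assume "(U', \<phi>') \<in> atlas (transport X f g M)" and c': "(V, \<psi>) \<in> atlas N"
      and x: "x \<in> \<phi>' ` (U' \<inter> (\<lambda>p. p) -` V)"
    then obtain U \<phi> where c: "(U, \<phi>) \<in> atlas M" and U': "U' = f ` U" "\<phi>' = \<phi> \<circ> g"
      by (elim atlas_transportE)
    have x': "x \<in> \<phi> ` (U \<inter> f -` V)"
      using x unfolding U' transport_image[OF c] vimage_ident .
    then have "frechet_derivative (\<psi> \<circ> f \<circ> inv_into U \<phi>) (at x) =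
        frechet_derivative (\<psi> \<circ> (\<lambda>p. p) \<circ> inv_into (f ` U) (\<phi> \<circ> g)) (at x)"
      by (intro frechet_derivative_cong_open[OF open_chart_image[OF c] _ eq[OF c]]) auto
    then show "inj (frechet_derivative (\<psi> \<circ> (\<lambda>p. p) \<circ> inv_into U' \<phi>') (at x))"
      using immersion_inj[OF f c c' x'] unfolding U' by simp
  qed
  then show ?thesis
    using N X sub smooth_manifold_transport by (simp add: embedded_submanifold_def)
qed

end

section \<open>The projective plane\<close>

lemma proj_rel_refl: "z \<noteq> 0 \<Longrightarrow> proj_rel z z"
  by (auto simp: proj_rel_def intro: exI[of _ 1])

text \<open>\<open>proj_rel\<close> is a partial equivalence, reflexive on nonzero vectors; for
  those, equality of classes is \<open>proj_rel\<close>.\<close>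

lemma abs_proj_plane_eq_iff:
  assumes "z \<noteq> 0" "w \<noteq> 0"
  shows "abs_proj_plane z = abs_proj_plane w \<longleftrightarrow> (\<exists>c. w = c *s z)"
proof -
  have "proj_rel z z" "proj_rel w w"
    using assms by (auto intro: proj_rel_refl)
  then have "proj_rel z w \<longleftrightarrow> abs_proj_plane z = abs_proj_plane w"
    using Quotient_rel[OF Quotient_proj_plane, of z w] by simp
  then show ?thesis using assms by (simp add: proj_rel_def)
qed

lemma abs_proj_plane_surj:
  obtains z where "z \<noteq> 0" "p = abs_proj_plane z"
proof
  have "proj_rel (rep_proj_plane p) (rep_proj_plane p)"
    by (rule Quotient_rep_reflp[OF Quotient_proj_plane])
  then show "rep_proj_plane p \<noteq> 0" by (simp add: proj_rel_def)
  show "p = abs_proj_plane (rep_proj_plane p)"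
    by (simp add: Quotient_abs_rep[OF Quotient_proj_plane])
qed

lemma affine_part_abs: "z \<noteq> 0 \<Longrightarrow> affine_part i (abs_proj_plane z) \<longleftrightarrow> z $ i \<noteq> 0"
  by (rule affine_part.abs_eq[OF proj_rel_refl])

text \<open>\<open>affine_coords\<close> on the level of vectors, where matrices act.\<close>

definition ratios :: "3 \<Rightarrow> 'k::field ^ 3 \<Rightarrow> 'k \<times> 'k" where
  "ratios i z = (z $ (i + 1) / z $ i, z $ (i + 2) / z $ i)"

lemma affine_coords_abs: "z \<noteq> 0 \<Longrightarrow> affine_coords i (abs_proj_plane z) = ratios i z"
  unfolding ratios_def by (rule affine_coords.abs_eq[OF proj_rel_refl])

text \<open>The representative with \<open>i\<close>-th coordinate 1 of the point with affine
  coordinates \<open>y\<close>.\<close>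

definition slot :: "3 \<Rightarrow> 'k \<times> 'k \<Rightarrow> 'k::field ^ 3" where
  "slot i y = (\<chi> k. if k = i then 1 else if k = i + 1 then fst y else snd y)"

lemma index3_distinct [simp]:
  fixes i :: 3
  shows "i + 1 \<noteq> i" "i + 2 \<noteq> i" "i + 2 \<noteq> i + 1" "i \<noteq> i + 1" "i \<noteq> i + 2" "i + 1 \<noteq> i + 2"
  using exhaust_3[of i] by auto

lemma index3_cases: fixes k i :: 3 shows "k = i \<or> k = i + 1 \<or> k = i + 2"
  using exhaust_3[of i] exhaust_3[of k] by auto

lemma slot_nth [simp]: "slot i y $ i = 1" "slot i y $ (i + 1) = fst y" "slot i y $ (i + 2) = snd y"
  by (simp_all add: slot_def)

lemma slot_nonzero [simp]: "slot i y \<noteq> 0"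
  using slot_nth(1)[of i y] by (metis zero_index zero_neq_one)

lemma ratios_slot [simp]: "ratios i (slot i y) = y"
  by (simp add: ratios_def)

lemma ratios_scale: "c \<noteq> 0 \<Longrightarrow> ratios i (c *s z) = ratios i z"
  by (simp add: ratios_def)

lemma slot_ratios:
  assumes "z $ i \<noteq> 0"
  shows "slot i (ratios i z) = inverse (z $ i) *s z"
proof -
  have "slot i (ratios i z) $ k = (inverse (z $ i) *s z) $ k" for k
    using index3_cases[of k i] assms by (elim disjE) (simp_all add: ratios_def divide_inverse)
  then show ?thesis by (simp add: vec_eq_iff)
qed

text \<open>The \<open>i\<close>-th entry of the slot is the constant 1, so every coordinate of the
  image is an affine function of \<open>y\<close>. This makes coordinate expressions quotients of
  affine functions.\<close>

lemma matrix_slot_nth: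
  "(A *v slot i y) $ k = A $ k $ i + (A $ k $ (i + 1) * fst y + A $ k $ (i + 2) * snd y)"
proof -
  \<comment> \<open>Listing the indices from \<open>i\<close> onwards lets \<open>slot_nth\<close>
    evaluate the sum for every \<open>i\<close> at once.\<close>
  have "(UNIV :: 3 set) = {i, i + 1, i + 2}" using index3_cases by auto
  then have "(A *v slot i y) $ k = (\<Sum>j\<in>{i, i + 1, i + 2}. A $ k $ j * slot i y $ j)"
    unfolding matrix_vector_mult_def by (simp only: vec_lambda_beta)
  then show ?thesis by simp
qed

definition proj_param :: "3 \<Rightarrow> 'k \<times> 'k \<Rightarrow> 'k::field proj_plane" where
  "proj_param i y = abs_proj_plane (slot i y)"

lemma affine_coords_param [simp]: "affine_coords i (proj_param i y) = y"
  by (simp add: proj_param_def affine_coords_abs)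

lemma affine_part_param [simp]: "affine_part i (proj_param i y)"
  by (simp add: proj_param_def affine_part_abs)

lemma proj_param_coords: "affine_part i p \<Longrightarrow> proj_param i (affine_coords i p) = p"
proof (rule abs_proj_plane_surj[of p])
  fix z assume z: "z \<noteq> 0" "p = abs_proj_plane z" and "affine_part i p"
  then have "z $ i \<noteq> 0" by (simp add: affine_part_abs)
  then have "z = z $ i *s slot i (ratios i z)"
    by (simp add: slot_ratios vector_smult_assoc)
  then show ?thesis
    using z by (auto simp: proj_param_def affine_coords_abs abs_proj_plane_eq_iff)
qed

lemma image_affine_coords [simp]: "affine_coords i ` {p. affine_part i p} = UNIV"
  by (metis (mono_tags, lifting) UNIV_eq_I affine_coords_param affine_part_param image_eqI mem_Collect_eq)

text \<open>Replaces the choice operator in the manifold conditions by the explicit inverse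
  chart.\<close>

lemma inv_into_affine_coords:
  "inv_into {p. affine_part i p} (affine_coords i) y = proj_param i y"
proof -
  have "inj_on (affine_coords i) {p. affine_part i p}"
    by (rule inj_on_inverseI[of _ "proj_param i"]) (simp add: proj_param_coords)
  then show ?thesis
    by (metis affine_coords_param affine_part_param inv_into_f_f mem_Collect_eq)
qed

section \<open>Topology of the projective plane and its charts\<close>

lemma open_proj_plane_iff:
  "open W \<longleftrightarrow> open {z. z \<noteq> 0 \<and> abs_proj_plane z \<in> W}"
  by (simp add: open_proj_plane_def)

lemma continuous_on_abs_proj_plane: "continuous_on (- {0}) abs_proj_plane"
proof -
  have "open (abs_proj_plane -` W \<inter> - {0})" if "open W" for W :: "'a proj_plane set"
  proof -
    have "abs_proj_plane -` W \<inter> - {0} = {z. z \<noteq> 0 \<and> abs_proj_plane z \<in> W}" by auto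
    then show ?thesis using that by (simp add: open_proj_plane_iff)
  qed
  then show ?thesis
    by (simp add: continuous_on_open_vimage open_Compl)
qed

text \<open>The universal property of the quotient topology, over an open set.\<close>

lemma continuous_on_proj_planeI:
  assumes "open W" "continuous_on {z. z \<noteq> 0 \<and> abs_proj_plane z \<in> W} (\<lambda>z. f (abs_proj_plane z))"
  shows "continuous_on W f"
proof -
  have "open (f -` T \<inter> W)" if "open T" for T
  proof -
    have "{z. z \<noteq> 0 \<and> abs_proj_plane z \<in> f -` T \<inter> W} =
        (\<lambda>z. f (abs_proj_plane z)) -` T \<inter> {z. z \<noteq> 0 \<and> abs_proj_plane z \<in> W}"
      by auto
    then show ?thesis
      using assms that open_proj_plane_iff[of W] open_proj_plane_iff[of "f -` T \<inter> W"]
      by (simp add: continuous_on_open_vimage)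
  qed
  then show ?thesis
    using assms(1) by (simp add: continuous_on_open_vimage)
qed

text \<open>The vectors whose class meets \<open>T\<close> form the union of the preimages of
  \<open>T\<close> under all nonzero scalings, and each of these is open.\<close>

lemma open_image_abs_proj_plane:
  fixes T :: "('k::real_normed_field ^ 3) set"
  assumes "open T" "0 \<notin> T"
  shows "open (abs_proj_plane ` T)"
proof -
  have "{z. z \<noteq> 0 \<and> abs_proj_plane z \<in> abs_proj_plane ` T} = (\<Union>c\<in>-{0}. (\<lambda>z. c *s z) -` T)" (is "?L = ?R")
  proof
    show "?L \<subseteq> ?R"
    proof
      fix z assume "z \<in> ?L"
      then obtain w where w: "z \<noteq> 0" "w \<in> T" "abs_proj_plane z = abs_proj_plane w" by auto
      then obtain c where "w = c *s z"
        using assms(2) abs_proj_plane_eq_iff by metis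
      moreover have "c \<noteq> 0" using calculation w assms(2) by auto
      ultimately show "z \<in> ?R" using w by auto
    qed
    show "?R \<subseteq> ?L"
    proof
      fix z assume "z \<in> ?R"
      then obtain c where c: "c *s z \<in> T" by auto
      then have "z \<noteq> 0" "c *s z \<noteq> 0" using assms(2) by auto
      then have "abs_proj_plane z = abs_proj_plane (c *s z)"
        by (auto simp: abs_proj_plane_eq_iff)
      then show "z \<in> ?L" using c \<open>z \<noteq> 0\<close> by auto
    qed
  qed
  moreover have "open ((\<lambda>z. c *s z) -` T)" for c
  proof -
    have "continuous_on UNIV (\<lambda>z::'k^3. c *s z)"
      unfolding vector_scalar_mult_def by (intro continuous_intros)
    then show ?thesis using assms(1) by (simp add: open_vimage)
  qed
  ultimately show ?thesis
    unfolding open_proj_plane_iff by auto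
qed

text \<open>Distinct points are separated by a 2 by 2 minor of two representatives: it stays nonzero
  near them but vanishes on every proportional pair.\<close>

lemma Hausdorff_proj_plane: "Hausdorff_space (euclidean :: 'k::real_normed_field proj_plane topology)"
proof -
  have "\<exists>V W. open V \<and> open W \<and> p \<in> V \<and> q \<in> W \<and> V \<inter> W = {}"
    if "p \<noteq> q" for p q :: "'k proj_plane"
  proof -
    obtain z w where z: "z \<noteq> 0" "p = abs_proj_plane z" and w: "w \<noteq> 0" "q = abs_proj_plane w"
      by (metis abs_proj_plane_surj)
    obtain i where i: "z $ i \<noteq> 0" using z(1) by (auto simp: vec_eq_iff)
    \<comment> \<open>Coordinate \<open>i\<close> forces the only possible factor of
      proportionality; it must fail at some coordinate \<open>j\<close>, and the minor for
      \<open>i\<close> and \<open>j\<close> is used.\<close>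
    have "w \<noteq> (w $ i / z $ i) *s z"
      using that z w abs_proj_plane_eq_iff by metis
    then obtain j where j: "w $ j \<noteq> w $ i / z $ i * z $ j"
      by (auto simp: vec_eq_iff)
    define m where "m = (\<lambda>v :: ('k ^ 3) \<times> ('k ^ 3). fst v $ i * snd v $ j - fst v $ j * snd v $ i)"
    have "m (z, w) \<noteq> 0" using i j by (auto simp: m_def field_simps)
    moreover have "open (m -` (- {0}))"
      unfolding m_def by (intro open_vimage continuous_intros)
    ultimately obtain A B where AB: "open A" "open B" "(z, w) \<in> A \<times> B" "A \<times> B \<subseteq> m -` (- {0})"
      using open_prod_elim[of "m -` (- {0})" "(z, w)"] by auto
    \<comment> \<open>The minor vanishes as soon as one of the vectors is zero.\<close>
    have A0: "0 \<notin> A" and B0: "0 \<notin> B" using AB by (auto simp: m_def)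
    have "abs_proj_plane ` A \<inter> abs_proj_plane ` B = {}"
    proof (rule ccontr)
      assume "\<not> ?thesis"
      then obtain a b where ab: "a \<in> A" "b \<in> B" "abs_proj_plane a = abs_proj_plane b" by auto
      then obtain c where "b = c *s a"
        using A0 B0 abs_proj_plane_eq_iff by metis
      then have "m (a, b) = 0" by (simp add: m_def)
      then show False using ab AB(4) by auto
    qed
    then show ?thesis
      using open_image_abs_proj_plane[OF AB(1) A0] open_image_abs_proj_plane[OF AB(2) B0] AB(3) z w
      by blast
  qed
  then show ?thesis
    unfolding Hausdorff_space_def disjnt_def by simp
qed

lemma second_countable_euclidean:
  "second_countable (euclidean :: 'a::second_countable_topology topology)"
proof -
  obtain B :: "'a set set" where "countable B" "topological_basis B"
    using ex_countable_basis by blast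
  then show ?thesis
    unfolding second_countable_def by (metis open_openin topological_basisE topological_basis_open)
qed

text \<open>Second countability passes from the nonzero vectors along the quotient map, a continuous
  open surjection.\<close>

lemma second_countable_proj_plane:
  "second_countable (euclidean :: 'k::{real_normed_field, euclidean_space} proj_plane topology)"
proof (rule second_countable_open_map_image)
  show "continuous_map (top_of_set (- {0 :: 'k ^ 3})) euclidean abs_proj_plane"
    using continuous_on_abs_proj_plane by simp
  show "open_map (top_of_set (- {0 :: 'k ^ 3})) euclidean abs_proj_plane"
    by (auto simp: open_map_def openin_open_eq open_Compl intro!: open_image_abs_proj_plane)
  show "abs_proj_plane ` topspace (top_of_set (- {0 :: 'k ^ 3})) = topspace euclidean"
  proof -
    have "p \<in> abs_proj_plane ` (- {0})" for p :: "'k proj_plane"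
      by (rule abs_proj_plane_surj[of p]) auto
    then show ?thesis by auto
  qed
  show "second_countable (top_of_set (- {0 :: 'k ^ 3}))"
    by (intro second_countable_subtopology) (rule second_countable_euclidean)
qed

lemma open_affine_part: "open {p :: 'k::real_normed_field proj_plane. affine_part i p}"
proof -
  \<comment> \<open>For \<open>z = 0\<close> both sides are false, whatever
    \<open>abs_proj_plane 0\<close> is.\<close>
  have "z \<noteq> 0 \<and> affine_part i (abs_proj_plane z) \<longleftrightarrow> z $ i \<noteq> 0" for z :: "'k ^ 3"
    using affine_part_abs[of z i] by (cases "z = 0") auto
  then have "{z :: 'k ^ 3. z \<noteq> 0 \<and> abs_proj_plane z \<in> {p. affine_part i p}} = (\<lambda>z. z $ i) -` (- {0})"
    by auto
  moreover have "open \<dots>" by (intro open_vimage continuous_intros)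
  ultimately show ?thesis by (simp add: open_proj_plane_iff)
qed

lemma continuous_on_affine_coords:
  "continuous_on {p :: 'k::real_normed_field proj_plane. affine_part i p} (affine_coords i)"
proof (rule continuous_on_proj_planeI[OF open_affine_part])
  have "continuous_on {z :: 'k ^ 3. z $ i \<noteq> 0} (ratios i)"
    unfolding ratios_def by (intro continuous_intros) auto
  then have "continuous_on {z :: 'k ^ 3. z \<noteq> 0 \<and> abs_proj_plane z \<in> {p. affine_part i p}} (ratios i)"
    by (rule continuous_on_subset) (auto simp: affine_part_abs)
  then show "continuous_on {z. z \<noteq> 0 \<and> abs_proj_plane z \<in> {p. affine_part i p}}
      (\<lambda>z. affine_coords i (abs_proj_plane z) :: 'k \<times> 'k)"
    by (rule continuous_on_eq) (auto simp: affine_coords_abs)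
qed

lemma continuous_on_proj_param: "continuous_on UNIV (proj_param i :: 'k::real_normed_field \<times> 'k \<Rightarrow> _)"
proof -
  have "continuous_on UNIV (slot i :: 'k \<times> 'k \<Rightarrow> _)"
    unfolding slot_def
  proof (rule continuous_on_vec_lambda)
    show "continuous_on UNIV (\<lambda>y :: 'k \<times> 'k. if k = i then 1 else if k = i + 1 then fst y else snd y)" for k
      by (cases "k = i"; cases "k = i + 1") (auto intro: continuous_intros)
  qed
  then show ?thesis
    unfolding proj_param_def
    by (rule continuous_on_compose2[OF continuous_on_abs_proj_plane]) auto
qed

lemma chart_affine_coords:
  "chart euclidean {p :: 'k::{real_normed_field, euclidean_space} proj_plane. affine_part i p} (affine_coords i)"
proof -
  have "homeomorphic_maps (top_of_set {p :: 'k proj_plane. affine_part i p}) euclidean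
      (affine_coords i) (proj_param i)"
    using continuous_on_affine_coords continuous_on_proj_param
    by (auto simp: homeomorphic_maps_def proj_param_coords continuous_map_in_subtopology)
  then show ?thesis
    using open_affine_part by (auto simp: chart_def homeomorphic_map_maps)
qed

text \<open>The parameter map \<open>\<iota>\<close> is the identity for coordinate changes and the inclusion of the real
  into the complex affine plane for the embedding.\<close>

lemma
  fixes A :: "'k::{real_normed_field, euclidean_space} ^ 3 ^ 3" and \<iota> :: "'e::euclidean_space \<Rightarrow> 'k \<times> 'k"
  assumes \<iota>: "bounded_linear \<iota>"
  shows open_matrix_slot: "open {y. (A *v slot i (\<iota> y)) $ j \<noteq> 0}"
    and smooth_on_ratios_matrix_slot:
      "smooth_on {y. (A *v slot i (\<iota> y)) $ j \<noteq> 0} (\<lambda>y. ratios j (A *v slot i (\<iota> y)))"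
proof -
  \<comment> \<open>\<open>L k\<close> is the linear part of the affine function that gives the
    \<open>k\<close>-th coordinate.\<close>
  define L where "L = (\<lambda>k y. A $ k $ (i + 1) * fst (\<iota> y) + A $ k $ (i + 2) * snd (\<iota> y))"
  have L: "bounded_linear (L k)" for k
    unfolding L_def using \<iota>
    by (intro bounded_linear_add bounded_linear_const_mult bounded_linear_fst_comp bounded_linear_snd_comp)
  have eq: "(A *v slot i (\<iota> y)) $ k = A $ k $ i + L k y" for k y
    by (simp add: matrix_slot_nth L_def)
  have "{y. (A *v slot i (\<iota> y)) $ j \<noteq> 0} = (\<lambda>y. A $ j $ i + L j y) -` (- {0})"
    by (auto simp: eq)
  moreover have "open \<dots>"
    by (intro open_vimage continuous_on_add continuous_on_const linear_continuous_on L) auto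
  ultimately show op: "open {y. (A *v slot i (\<iota> y)) $ j \<noteq> 0}" by simp
  have "smooth_on {y. (A *v slot i (\<iota> y)) $ j \<noteq> 0} (\<lambda>y. (A *v slot i (\<iota> y)) $ k)" for k
    using op by (simp add: smooth_on_def eq Ck_on_affine L)
  then show "smooth_on {y. (A *v slot i (\<iota> y)) $ j \<noteq> 0} (\<lambda>y. ratios j (A *v slot i (\<iota> y)))"
    unfolding ratios_def by (intro smooth_on_Pair smooth_on_divide op) auto
qed

lemma smooth_manifold_projective_plane:
  "smooth_manifold (projective_plane :: ('k::{real_normed_field, euclidean_space} proj_plane, _) manifold)"
proof (rule smooth_manifoldI)
  show "Hausdorff_space (mtop (projective_plane :: ('k proj_plane, _) manifold))"
    by (simp add: projective_plane_def Hausdorff_proj_plane)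
  show "second_countable (mtop (projective_plane :: ('k proj_plane, _) manifold))"
    by (simp add: projective_plane_def second_countable_proj_plane)
  show "\<Union> (fst ` atlas projective_plane) = topspace (mtop (projective_plane :: ('k proj_plane, _) manifold))"
  proof -
    have "\<exists>i. affine_part i p" for p :: "'k proj_plane"
    proof (rule abs_proj_plane_surj[of p])
      fix z assume "z \<noteq> 0" "p = abs_proj_plane z"
      then show ?thesis by (auto simp: affine_part_abs vec_eq_iff)
    qed
    then show ?thesis by (auto simp: projective_plane_def)
  qed
next
  fix U :: "'k proj_plane set" and \<phi> assume "(U, \<phi>) \<in> atlas projective_plane"
  then show "chart (mtop projective_plane) U \<phi>"
    using chart_affine_coords by (auto simp: projective_plane_def)
next
  fix U V :: "'k proj_plane set" and \<phi> \<psi>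
  assume "(U, \<phi>) \<in> atlas projective_plane" "(V, \<psi>) \<in> atlas projective_plane"
  then obtain i j where U: "U = {p. affine_part i p}" "\<phi> = affine_coords i"
    and V: "V = {p. affine_part j p}" "\<psi> = affine_coords j"
    by (auto simp: projective_plane_def)
  \<comment> \<open>A change of affine coordinates is the matrix map of the identity matrix.\<close>
  have "\<phi> ` (U \<inter> V) = {y. (mat 1 *v slot i y) $ j \<noteq> 0}"
  proof -
    have "\<phi> ` (U \<inter> V) = {y. affine_part j (proj_param i y)}"
      unfolding U V by (force simp: proj_param_coords image_iff intro: bexI[where x = "proj_param i _"])
    then show ?thesis by (simp add: proj_param_def affine_part_abs)
  qed
  moreover have "\<psi> \<circ> inv_into U \<phi> = (\<lambda>y. ratios j (mat 1 *v slot i y))"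
    unfolding U V by (auto simp: inv_into_affine_coords proj_param_def affine_coords_abs)
  ultimately show "smooth_on (\<phi> ` (U \<inter> V)) (\<psi> \<circ> inv_into U \<phi>)"
    using smooth_on_ratios_matrix_slot[OF bounded_linear_ident, of "mat 1"] by simp
qed

section \<open>Embeddings of the real projective plane\<close>

definition of_real_vec :: "real ^ 'n \<Rightarrow> ('k::real_algebra_1) ^ 'n" where
  "of_real_vec x = (\<chi> k. of_real (x $ k))"

lemma of_real_vec_nth [simp]: "of_real_vec x $ k = of_real (x $ k)"
  by (simp add: of_real_vec_def)

lemma of_real_vec_eq_0_iff [simp]: "of_real_vec x = (0 :: ('k::real_normed_field) ^ 'n) \<longleftrightarrow> x = 0"
  by (auto simp: vec_eq_iff)

lemma of_real_vec_eqD: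
  assumes "of_real_vec x = (of_real_vec y :: ('k::real_normed_field) ^ 'n)"
  shows "x = y"
proof -
  have "x $ k = y $ k" for k
    using arg_cong[OF assms, of "\<lambda>v. v $ k"] by simp
  then show ?thesis by (simp add: vec_eq_iff)
qed

lemma of_real_vec_scale: "of_real_vec (c *s x) = (of_real c *s of_real_vec x :: ('k::real_normed_field) ^ 'n)"
  by (simp add: vec_eq_iff)

lemma of_real_vec_slot:
  "of_real_vec (slot i y) = (slot i (map_prod of_real of_real y) :: ('k::real_normed_field) ^ 3)"
  by (simp add: vec_eq_iff slot_def)

text \<open>Formulated with the chosen representative; \<open>proj_embed_abs\<close> shows
  independence of it when \<open>A\<close> has a left inverse.\<close>

definition proj_embed ::
  "'k::real_normed_field ^ 3 ^ 3 \<Rightarrow> real proj_plane \<Rightarrow> 'k proj_plane" where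
  "proj_embed A p = abs_proj_plane (A *v of_real_vec (rep_proj_plane p))"

text \<open>Dividing a representative by its norm shows that the unit sphere maps onto the real
  projective plane.\<close>

lemma compact_real_proj_plane: "compact (UNIV :: real proj_plane set)"
proof -
  have "p \<in> abs_proj_plane ` sphere 0 1" for p :: "real proj_plane"
  proof (rule abs_proj_plane_surj[of p])
    fix z assume z: "z \<noteq> 0" "p = abs_proj_plane z"
    have "abs_proj_plane z = abs_proj_plane (inverse (norm z) *s z)"
      using z by (subst abs_proj_plane_eq_iff) auto
    then show ?thesis
      using z by (auto simp: scalar_mult_eq_scaleR intro!: image_eqI)
  qed
  moreover have "compact (abs_proj_plane ` sphere (0 :: real ^ 3) 1)"
    by (intro compact_continuous_image continuous_on_subset[OF continuous_on_abs_proj_plane]) auto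
  moreover have "(UNIV :: real proj_plane set) = abs_proj_plane ` sphere 0 1"
    using calculation(1) by blast
  ultimately show ?thesis by simp
qed

context
  fixes A B :: "'k::{real_normed_field, euclidean_space} ^ 3 ^ 3"
  assumes BA: "B ** A = mat 1"
begin

lemma left_inverse_mult: "B *v (A *v x) = x"
  by (simp add: matrix_vector_mul_assoc BA)

lemma mult_eq_0_iff: "A *v x = 0 \<longleftrightarrow> x = 0"
  using left_inverse_mult[of x] by (metis matrix_vector_mult_0_right)

text \<open>Representatives differ by a real factor \<open>c\<close>, their images by
  \<open>of_real c\<close>; the left inverse of \<open>A\<close> keeps both images nonzero.\<close>

lemma proj_embed_abs:
  assumes "z \<noteq> 0"
  shows "proj_embed A (abs_proj_plane z) = abs_proj_plane (A *v of_real_vec z)"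
proof (rule abs_proj_plane_surj[of "abs_proj_plane z"])
  define w where "w = rep_proj_plane (abs_proj_plane z)"
  have "proj_rel w w"
    unfolding w_def by (rule Quotient_rep_reflp[OF Quotient_proj_plane])
  then have "w \<noteq> 0" by (simp add: proj_rel_def)
  moreover have "abs_proj_plane z = abs_proj_plane w"
    by (simp add: w_def Quotient_abs_rep[OF Quotient_proj_plane])
  ultimately obtain c where "w = c *s z"
    using assms abs_proj_plane_eq_iff by blast
  then show ?thesis
    using assms \<open>w \<noteq> 0\<close> unfolding proj_embed_def w_def[symmetric]
    by (subst eq_commute)
       (auto simp: abs_proj_plane_eq_iff mult_eq_0_iff of_real_vec_scale vector_scalar_commute)
qed

text \<open>After applying \<open>B\<close>, the two real vectors are proportional over
  \<open>'k\<close>. The factor is in fact real, so they are proportional over the reals.\<close>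

lemma inj_proj_embed: "inj (proj_embed A)"
proof (rule injI)
  fix p q assume eq: "proj_embed A p = proj_embed A q"
  obtain z w where z: "z \<noteq> 0" "p = abs_proj_plane z" and w: "w \<noteq> 0" "q = abs_proj_plane w"
    by (metis abs_proj_plane_surj)
  have "abs_proj_plane (A *v of_real_vec z) = abs_proj_plane (A *v of_real_vec w)"
    using eq z w by (simp add: proj_embed_abs)
  then obtain c where "A *v of_real_vec w = c *s (A *v of_real_vec z)"
    using z w by (subst (asm) abs_proj_plane_eq_iff) (auto simp: mult_eq_0_iff)
  then have "B *v (A *v of_real_vec w) = B *v (A *v (c *s of_real_vec z))"
    by (simp add: vector_scalar_commute)
  then have c: "of_real_vec w = c *s of_real_vec z"
    by (simp only: left_inverse_mult)
  obtain i where i: "z $ i \<noteq> 0" using z(1) by (auto simp: vec_eq_iff)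
  \<comment> \<open>The factor is a quotient of two real entries, the denominator being
    nonzero.\<close>
  have "c = of_real (w $ i / z $ i)"
    using i arg_cong[OF c, of "\<lambda>v. v $ i"] by (simp add: field_simps)
  then have "of_real_vec w = (of_real_vec ((w $ i / z $ i) *s z) :: 'k ^ 3)"
    using c of_real_vec_scale by metis
  then have "w = (w $ i / z $ i) *s z"
    by (rule of_real_vec_eqD)
  then show "p = q"
    using z w abs_proj_plane_eq_iff by blast
qed

lemma continuous_proj_embed: "continuous_on UNIV (proj_embed A)"
proof (rule continuous_on_proj_planeI)
  have "continuous_on {z. z \<noteq> 0} (\<lambda>z. A *v of_real_vec z)"
    unfolding matrix_vector_mult_def of_real_vec_def vec_lambda_beta
    by (intro continuous_intros)
  then have "continuous_on {z. z \<noteq> 0} (\<lambda>z. abs_proj_plane (A *v of_real_vec z))"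
    by (rule continuous_on_compose2[OF continuous_on_abs_proj_plane]) (auto simp: mult_eq_0_iff)
  then show "continuous_on {z. z \<noteq> 0 \<and> abs_proj_plane z \<in> UNIV} (\<lambda>z. proj_embed A (abs_proj_plane z))"
    by (auto intro: continuous_on_eq simp: proj_embed_abs)
qed simp

text \<open>A continuous map from a compact space to a Hausdorff space is closed, and an injective
  closed continuous map is an embedding.\<close>

lemma homeomorphic_proj_embed:
  "homeomorphic_map euclidean (top_of_set (range (proj_embed A))) (proj_embed A)"
proof -
  have cont: "continuous_map euclidean euclidean (proj_embed A)"
    using continuous_proj_embed by simp
  have "closed_map euclidean euclidean (proj_embed A)"
    by (rule continuous_imp_closed_map[OF cont])
       (simp_all add: compact_space_def compact_real_proj_plane Hausdorff_proj_plane)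
  then have "embedding_map euclidean euclidean (proj_embed A)"
    using cont inj_proj_embed by (intro injective_closed_imp_embedding_map) auto
  then show ?thesis by (simp add: embedding_map_def)
qed

lemma immersion_proj_embed: "immersion projective_plane projective_plane (proj_embed A)"
proof -
  let ?\<iota> = "map_prod of_real of_real :: real \<times> real \<Rightarrow> 'k \<times> 'k"
  have lin: "bounded_linear ?\<iota>"
    unfolding map_prod_def case_prod_unfold
    by (intro bounded_linear_Pair bounded_linear_fst_comp bounded_linear_snd_comp
        bounded_linear_of_real[THEN bounded_linear_compose] bounded_linear_fst bounded_linear_snd)
  have inj: "inj ?\<iota>" by (auto simp: inj_on_def)
  have param: "proj_embed A (proj_param i y) = abs_proj_plane (A *v slot i (?\<iota> y))" for i y
    by (simp add: proj_param_def proj_embed_abs of_real_vec_slot)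
  have dom: "affine_coords i ` ({p. affine_part i p} \<inter> proj_embed A -` {p. affine_part j p}) =
      {y. (A *v slot i (?\<iota> y)) $ j \<noteq> 0}" (is "?L = _") for i j
  proof -
    have "?L = {y. affine_part j (proj_embed A (proj_param i y))}"
      by (force simp: proj_param_coords image_iff intro: bexI[where x = "proj_param i _"])
    then show ?thesis by (simp add: param affine_part_abs mult_eq_0_iff)
  qed
  have map: "affine_coords j \<circ> proj_embed A \<circ> inv_into {p. affine_part i p} (affine_coords i) =
      (\<lambda>y. ratios j (A *v slot i (?\<iota> y)))" for i j
    by (auto simp: inv_into_affine_coords param affine_coords_abs mult_eq_0_iff)
  have smooth: "smooth_on {y. (A *v slot i (?\<iota> y)) $ j \<noteq> 0} (\<lambda>y. ratios j (A *v slot i (?\<iota> y)))" for i j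
    by (rule smooth_on_ratios_matrix_slot[OF lin])
  have inj': "inj (frechet_derivative (\<lambda>y. ratios j (A *v slot i (?\<iota> y))) (at x))"
    if x: "(A *v slot i (?\<iota> x)) $ j \<noteq> 0" for i j x
  proof (rule inj_frechet_derivative_left_inverse[where g = "\<lambda>y. ratios i (B *v slot j y)" and \<iota> = ?\<iota>])
    \<comment> \<open>Passing to the slot divides by the \<open>j\<close>-th coordinate, so
      \<open>B\<close> recovers the original slot only up to a nonzero factor;
      \<open>ratios i\<close> ignores that factor.\<close>
    have B: "B *v slot j (ratios j (A *v slot i (?\<iota> y))) = inverse ((A *v slot i (?\<iota> y)) $ j) *s slot i (?\<iota> y)"
      if "(A *v slot i (?\<iota> y)) $ j \<noteq> 0" for y
      by (simp add: slot_ratios[OF that] vector_scalar_commute left_inverse_mult)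
    show "(\<lambda>y. ratios j (A *v slot i (?\<iota> y))) differentiable (at x)"
      by (rule smooth_on_differentiable[OF smooth]) (simp add: x)
    \<comment> \<open>The denominator of the left inverse is nonzero here: by \<open>B\<close> it is
      the inverse of a nonzero coordinate.\<close>
    show "(\<lambda>y. ratios i (B *v slot j y)) differentiable (at (ratios j (A *v slot i (?\<iota> x))))"
      by (rule smooth_on_differentiable[OF smooth_on_ratios_matrix_slot[OF bounded_linear_ident]])
         (use x in \<open>simp add: B\<close>)
    show "ratios i (B *v slot j (ratios j (A *v slot i (?\<iota> y)))) = ?\<iota> y"
      if "y \<in> {y. (A *v slot i (?\<iota> y)) $ j \<noteq> 0}" for y
      using that by (simp add: B ratios_scale)
  qed (use x open_matrix_slot[OF lin] lin inj in auto)
  have "smooth_map projective_plane projective_plane (proj_embed A)"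
  proof (rule smooth_mapI)
    show "continuous_map (mtop projective_plane) (mtop projective_plane) (proj_embed A)"
      using continuous_proj_embed by (simp add: projective_plane_def)
  next
    fix U \<phi> V \<psi>
    assume "(U, \<phi>) \<in> atlas RP2" "(V, \<psi>) \<in> atlas (projective_plane :: ('k proj_plane, _) manifold)"
    then obtain i j where U: "U = {p. affine_part i p}" "\<phi> = affine_coords i"
      and V: "V = {p. affine_part j p}" "\<psi> = affine_coords j"
      by (auto simp: projective_plane_def)
    show "smooth_on (\<phi> ` (U \<inter> proj_embed A -` V)) (\<psi> \<circ> proj_embed A \<circ> inv_into U \<phi>)"
      unfolding U V dom map by (rule smooth)
  qed
  then show ?thesis
  proof (rule immersionI)
    fix U \<phi> V \<psi> x
    assume "(U, \<phi>) \<in> atlas RP2" "(V, \<psi>) \<in> atlas (projective_plane :: ('k proj_plane, _) manifold)"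
      and x: "x \<in> \<phi> ` (U \<inter> proj_embed A -` V)"
    then obtain i j where U: "U = {p. affine_part i p}" "\<phi> = affine_coords i"
      and V: "V = {p. affine_part j p}" "\<psi> = affine_coords j"
      by (auto simp: projective_plane_def)
    show "inj (frechet_derivative (\<psi> \<circ> proj_embed A \<circ> inv_into U \<phi>) (at x))"
      unfolding U V map by (rule inj') (use x[unfolded U V dom] in simp)
  qed
qed

end

section \<open>The Hopf fibration and the matrix of \<open>L2\<close>\<close>

text \<open>The product of \<open>\<alpha> + \<i> * \<beta>\<close> and
  \<open>\<alpha> - \<i> * \<beta>\<close> is \<open>\<alpha>\<^sup>2 + \<beta>\<^sup>2\<close>, and
  the required equations give them the squared moduli \<open>1 - Z\<close> and \<open>1 + Z\<close>.
  A common phase is free, so the second may be the real number \<open>b\<close>; the first is then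
  \<open>a\<close> times a unit number carrying the argument of \<open>Complex X Y\<close>.\<close>

lemma L2_parametrization:
  fixes X Y Z :: real
  assumes "X\<^sup>2 + Y\<^sup>2 + Z\<^sup>2 = 1"
  obtains \<alpha> \<beta> where "(cmod \<alpha>)\<^sup>2 + (cmod \<beta>)\<^sup>2 = 1"
    "\<alpha>\<^sup>2 + \<beta>\<^sup>2 = Complex X Y" "cnj \<alpha> * \<beta> - \<alpha> * cnj \<beta> = \<i> * of_real Z"
proof -
  define a b where "a = sqrt (1 - Z)" and "b = sqrt (1 + Z)"
  have "Z\<^sup>2 \<le> 1" using assms by (smt (verit) zero_le_power2)
  then have Z: "\<bar>Z\<bar> \<le> 1" using abs_square_le_1 by blast
  then have ab: "a\<^sup>2 = 1 - Z" "b\<^sup>2 = 1 + Z" by (auto simp: a_def b_def)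
  have "sqrt (1 - Z\<^sup>2) = a * b"
    unfolding a_def b_def real_sqrt_mult[symmetric] by (simp add: algebra_simps power2_eq_square)
  moreover have "cmod (Complex X Y) = sqrt (1 - Z\<^sup>2)"
    using assms by (simp add: complex_norm eq_diff_eq)
  ultimately have m: "cmod (Complex X Y) = a * b" by simp
  \<comment> \<open>If \<open>Complex X Y\<close> is 0, the default value of \<open>Arg\<close> does
    no harm, since then \<open>a * b = 0\<close>.\<close>
  define c s where "c = cos (Arg (Complex X Y))" and "s = sin (Arg (Complex X Y))"
  have cs: "c\<^sup>2 + s\<^sup>2 = 1" by (simp add: c_def s_def)
  have XY: "X = a * b * c" "Y = a * b * s"
    using rcis_cmod_Arg[of "Complex X Y"] m
    by (auto simp: rcis_def cis.ctr complex_eq_iff c_def s_def)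
  \<comment> \<open>These solve \<open>\<alpha> + \<i> * \<beta> = a * Complex c s\<close> and
    \<open>\<alpha> - \<i> * \<beta> = b\<close>.\<close>
  define \<alpha> \<beta> where "\<alpha> = Complex ((a * c + b) / 2) (a * s / 2)"
    and "\<beta> = Complex (a * s / 2) ((b - a * c) / 2)"
  have s2: "s\<^sup>2 = 1 - c\<^sup>2" using cs by simp
  show thesis
  proof
    have "(cmod \<alpha>)\<^sup>2 + (cmod \<beta>)\<^sup>2 = (a\<^sup>2 * (c\<^sup>2 + s\<^sup>2) + b\<^sup>2) / 2"
      unfolding cmod_power2 by (simp add: \<alpha>_def \<beta>_def power2_eq_square field_simps)
    then show "(cmod \<alpha>)\<^sup>2 + (cmod \<beta>)\<^sup>2 = 1" by (simp add: cs ab)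
    show "\<alpha>\<^sup>2 + \<beta>\<^sup>2 = Complex X Y"
      by (simp add: \<alpha>_def \<beta>_def XY complex_eq_iff power2_eq_square field_simps)
    have "cnj \<alpha> * \<beta> - \<alpha> * cnj \<beta> = \<i> * of_real ((b\<^sup>2 - a\<^sup>2 * (c\<^sup>2 + s\<^sup>2)) / 2)"
      by (simp add: \<alpha>_def \<beta>_def complex_eq_iff power2_eq_square field_simps)
    then show "cnj \<alpha> * \<beta> - \<alpha> * cnj \<beta> = \<i> * of_real Z" by (simp add: cs ab)
  qed
qed

text \<open>The rows are the homogeneous coordinates \<open>[X - iY : i sqrt 2 Z : X + iY]\<close>
  as linear forms in \<open>X\<close>, \<open>Y\<close>, \<open>Z\<close>.\<close>

definition L2_matrix :: "complex ^ 3 ^ 3" where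
  "L2_matrix = vector [vector [1, - \<i>, 0], vector [0, 0, complex_of_real (sqrt 2) * \<i>], vector [1, \<i>, 0]]"

lemma L2_matrix_mult:
  "L2_matrix *v of_real_vec x =
     vector [Complex (x $ 1) (- x $ 2), complex_of_real (sqrt 2) * (\<i> * of_real (x $ 3)), Complex (x $ 1) (x $ 2)]"
  by (simp add: L2_matrix_def vec_eq_iff forall_3 matrix_vector_mult_def sum_3 Complex_eq algebra_simps)

text \<open>The determinant is \<open>2 * sqrt 2\<close>.\<close>

lemma invertible_L2_matrix: "invertible L2_matrix"
  by (simp add: invertible_det_nz det_3 L2_matrix_def)

lemma range_proj_embed_L2_matrix: "range (proj_embed L2_matrix) = L2"
proof -
  obtain B where B: "B ** L2_matrix = mat 1"
    using invertible_L2_matrix by (auto simp: invertible_def)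
  show ?thesis
  proof
    show "range (proj_embed L2_matrix) \<subseteq> L2"
    proof safe
      fix p
      obtain z :: "real ^ 3" where z: "z \<noteq> 0" "p = abs_proj_plane z" by (rule abs_proj_plane_surj)
      \<comment> \<open>A representative on the unit sphere, as \<open>L2_parametrization\<close>
        demands.\<close>
      define x where "x = inverse (norm z) *s z"
      have x: "norm x = 1" "x \<noteq> 0" using z by (auto simp: x_def scalar_mult_eq_scaleR)
      have p: "p = abs_proj_plane x"
        using z x by (auto simp: abs_proj_plane_eq_iff x_def)
      have "(x $ 1)\<^sup>2 + (x $ 2)\<^sup>2 + (x $ 3)\<^sup>2 = 1"
        using x(1) by (simp add: norm_vec_def L2_set_def sum_3)
      then obtain \<alpha> \<beta> where ab: "(cmod \<alpha>)\<^sup>2 + (cmod \<beta>)\<^sup>2 = 1"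
        "\<alpha>\<^sup>2 + \<beta>\<^sup>2 = Complex (x $ 1) (x $ 2)" "cnj \<alpha> * \<beta> - \<alpha> * cnj \<beta> = \<i> * of_real (x $ 3)"
        by (rule L2_parametrization)
      have "(cnj \<alpha>)\<^sup>2 + (cnj \<beta>)\<^sup>2 = Complex (x $ 1) (- x $ 2)"
        using arg_cong[OF ab(2), of cnj] by (simp add: complex_eq_iff)
      then have "proj_embed L2_matrix p = hom_coords ((cnj \<alpha>)\<^sup>2 + (cnj \<beta>)\<^sup>2)
          (complex_of_real (sqrt 2) * (cnj \<alpha> * \<beta> - \<alpha> * cnj \<beta>)) (\<alpha>\<^sup>2 + \<beta>\<^sup>2)"
        unfolding hom_coords_def p proj_embed_abs[OF B x(2)] L2_matrix_mult ab by simp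
      then show "proj_embed L2_matrix p \<in> L2"
        using ab(1) unfolding L2_def by blast
    qed
    show "L2 \<subseteq> range (proj_embed L2_matrix)"
    proof
      fix q assume "q \<in> L2"
      then obtain \<alpha> \<beta> where ab: "(cmod \<alpha>)\<^sup>2 + (cmod \<beta>)\<^sup>2 = 1"
        and q: "q = hom_coords ((cnj \<alpha>)\<^sup>2 + (cnj \<beta>)\<^sup>2)
          (complex_of_real (sqrt 2) * (cnj \<alpha> * \<beta> - \<alpha> * cnj \<beta>)) (\<alpha>\<^sup>2 + \<beta>\<^sup>2)"
        unfolding L2_def by blast
      \<comment> \<open>\<open>cnj \<alpha> * \<beta> - \<alpha> * cnj \<beta>\<close> is purely
        imaginary, so its imaginary part determines it.\<close>
      define x :: "real ^ 3" where
        "x = vector [Re (\<alpha>\<^sup>2 + \<beta>\<^sup>2), Im (\<alpha>\<^sup>2 + \<beta>\<^sup>2), Im (cnj \<alpha> * \<beta> - \<alpha> * cnj \<beta>)]"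
      \<comment> \<open>The identity behind the Hopf map: it puts \<open>x\<close> on the unit
        sphere, away from 0.\<close>
      have "(x $ 1)\<^sup>2 + (x $ 2)\<^sup>2 + (x $ 3)\<^sup>2 = ((cmod \<alpha>)\<^sup>2 + (cmod \<beta>)\<^sup>2)\<^sup>2"
        unfolding cmod_power2 by (simp add: x_def power2_eq_square algebra_simps)
      then have "x \<noteq> 0" using ab by auto
      have "L2_matrix *v of_real_vec x = vector [(cnj \<alpha>)\<^sup>2 + (cnj \<beta>)\<^sup>2,
          complex_of_real (sqrt 2) * (cnj \<alpha> * \<beta> - \<alpha> * cnj \<beta>), \<alpha>\<^sup>2 + \<beta>\<^sup>2]"
        unfolding L2_matrix_mult
        by (simp add: x_def vec_eq_iff forall_3 complex_eq_iff power2_eq_square)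
      then have "q = proj_embed L2_matrix (abs_proj_plane x)"
        by (simp add: q hom_coords_def proj_embed_abs[OF B \<open>x \<noteq> 0\<close>])
      then show "q \<in> range (proj_embed L2_matrix)" by simp
    qed
  qed
qed

theorem lemma2p1:
  shows "\<exists>S :: (complex proj_plane, real \<times> real) manifold.
           topspace (mtop S) = L2 \<and> embedded_submanifold S CP2 \<and> diffeomorphic S RP2"
proof -
  let ?f = "proj_embed L2_matrix"
  obtain B where B: "B ** L2_matrix = mat 1"
    using invertible_L2_matrix by (auto simp: invertible_def)
  have "homeomorphic_map (mtop RP2) (top_of_set L2) ?f"
    using homeomorphic_proj_embed[OF B] by (simp add: range_proj_embed_L2_matrix projective_plane_def)
  \<comment> \<open>\<open>g\<close> inverts the embedding on \<open>L2\<close>, and the charts of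
    the submanifold are those of \<open>RP2\<close> composed with \<open>g\<close>.\<close>
  then obtain g where g: "homeomorphic_maps (mtop RP2) (top_of_set L2) ?f g"
    unfolding homeomorphic_map_maps by blast
  have "top_of_set L2 = subtopology (mtop CP2) (topspace (top_of_set L2))"
    by (simp add: projective_plane_def)
  then have "embedded_submanifold (transport (top_of_set L2) ?f g RP2) CP2"
    by (rule embedded_submanifold_transport[OF smooth_manifold_projective_plane g
        smooth_manifold_projective_plane _ immersion_proj_embed[OF B]])
  moreover have "diffeomorphic (transport (top_of_set L2) ?f g RP2) RP2"
    by (rule diffeomorphic_transport[OF smooth_manifold_projective_plane g])
  moreover have "topspace (mtop (transport (top_of_set L2) ?f g RP2)) = L2"
    by simp
  ultimately show ?thesis by blast
qed

end
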